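(* Let $r\equiv1\pmod4$ with $r\ge9$, and let $H$ be an $ABAB$ starter in $\mathcal C_4(r)$, arising from a normalized directed $R^*$-terrace of $\mathbb Z_r$. Then the path $0\to2\to4\to\cdots\to2r$ in $\mathcal C_4(r)$ is rainbow for the development colouring of $H$, i.e. its $r$ arcs belong to $r$ pairwise distinct cycles among $H_k=H+4k$, $k\in\mathbb Z_r$. Hence $H$ is chain-compatible.
   Context: Let $[r]=\{1,\ldots,r\}$; for nonzero $x\in\mathbb Z_r$, $[x]_r\in\{1,\ldots,r-1\}$ is its representative. $\mathcal C_4(r)$ is the directed Cayley digraph on $\mathbb Z_{4r}$ with arcs $x\to x+s$, $s\in[r]$ (tail $x$, step $s$). A $4$-layer balanced Hamilton starter is a directed Hamilton cycle containing, for each $(j,s)\in\mathbb Z_4\times[r]$, exactly one arc of step $s$ with tail congruent to $j$ mod $4$. A directed rotational terrace of $\mathbb Z_r$ is a cyclic ordering $(P_0,\ldots,P_{r-2})$ of $\mathbb Z_r\setminus\{0\}$ whose cyclic differences $d_i=[P_{i+1}-P_i]_r$ ($i\in\mathbb Z_{r-1}$) run through $1,\ldots,r-1$ exactly once. It is a normalized directed $R^*$-terrace if $P_1=P_0+P_2$ in $\mathbb Z_r$ and both integers $a:=d_0$ and $b:=d_1$ are odd. Write its difference word as $(d_0,\ldots,d_{r-2})=(a,b,D')$. Put $A=(a,r,b,D')$ and $B=(b,r,a,D')$ (both permutations of $[r]$). The $ABAB$ starter $H$ is the closed walk in $\mathcal C_4(r)$ starting at $0$ whose successive steps are the letters of the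 concatenated word $ABAB$; it is a $4$-layer balanced Hamilton starter (a fact established in the paper). The translates $H_k=H+4k$ ($k\in\mathbb Z_r$) partition the arcs of $\mathcal C_4(r)$; the development colour of an arc is the unique $k$ with the arc in $H_k$. $H$ is chain-compatible if one arc can be selected from each $H_k$ ($k\in\mathbb Z_r$) so that the selected $r$ arcs form a simple directed path (with $r+1$ pairwise distinct vertices). *)

theory Defs
  imports "Graph_Theory.Graph_Theory"
begin

text \<open>
  Residues are represented by their least nonnegative integer representatives: the elements of
  \<open>\<int>\<^sub>n\<close> are the integers in \<open>{0..<n}\<close>, and sums and differences are reduced with
  \<open>mod\<close>. An arc is a pair (tail, head); since \<open>r < 4 * r\<close>, an arc of \<open>\<C>\<^sub>4(r)\<close>
  determines its step.
\<close>

definition C4 :: "nat \<Rightarrow> int pair_pre_digraph" where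
  "C4 r = \<lparr> pverts = {0..<4 * int r},
            parcs = {(x, (x + s) mod (4 * int r)) | x s. x \<in> {0..<4 * int r} \<and> s \<in> {1..int r}} \<rparr>"

definition cyclic_diffs :: "nat \<Rightarrow> int list \<Rightarrow> int list" where
  "cyclic_diffs r P =
     map (\<lambda>i. (P ! (Suc i mod length P) - P ! i) mod int r) [0..<length P]"

definition directed_rotational_terrace :: "nat \<Rightarrow> int list \<Rightarrow> bool" where
  "directed_rotational_terrace r P \<longleftrightarrow>
     distinct P \<and> set P = {1..<int r} \<and>
     distinct (cyclic_diffs r P) \<and> set (cyclic_diffs r P) = {1..<int r}"

definition normalized_Rstar_terrace :: "nat \<Rightarrow> int list \<Rightarrow> bool" where
  "normalized_Rstar_terrace r P \<longleftrightarrow>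
     directed_rotational_terrace r P \<and>
     P ! 1 = (P ! 0 + P ! 2) mod int r \<and>
     odd (cyclic_diffs r P ! 0) \<and> odd (cyclic_diffs r P ! 1)"

definition word_A :: "nat \<Rightarrow> int list \<Rightarrow> int list" where
  "word_A r P =
     [cyclic_diffs r P ! 0, int r, cyclic_diffs r P ! 1] @ drop 2 (cyclic_diffs r P)"

definition word_B :: "nat \<Rightarrow> int list \<Rightarrow> int list" where
  "word_B r P =
     [cyclic_diffs r P ! 1, int r, cyclic_diffs r P ! 0] @ drop 2 (cyclic_diffs r P)"

text \<open>The arc sequence of the walk in \<open>\<int>\<^sub>n\<close> with given initial vertex and given successive steps.\<close>

primrec walk_of_steps :: "int \<Rightarrow> int \<Rightarrow> int list \<Rightarrow> (int \<times> int) list" where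
  "walk_of_steps n x [] = []"
| "walk_of_steps n x (s # w) = (x, (x + s) mod n) # walk_of_steps n ((x + s) mod n) w"

definition ABAB_starter :: "nat \<Rightarrow> int list \<Rightarrow> (int \<times> int) list" where
  "ABAB_starter r P =
     walk_of_steps (4 * int r) 0 (word_A r P @ word_B r P @ word_A r P @ word_B r P)"

definition translate :: "nat \<Rightarrow> (int \<times> int) list \<Rightarrow> int \<Rightarrow> (int \<times> int) list" where
  "translate r H k =
     map (\<lambda>(x, y). ((x + 4 * k) mod (4 * int r), (y + 4 * k) mod (4 * int r))) H"

definition dev_colour :: "nat \<Rightarrow> (int \<times> int) list \<Rightarrow> int \<times> int \<Rightarrow> int" where
  "dev_colour r H e = (THE k. k \<in> {0..<int r} \<and> e \<in> set (translate r H k))"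

text \<open>
  The first conjunct says that every arc of \<open>p\<close> has a well-defined colour, so that the
  description operator in \<open>dev_colour\<close> is meaningful on \<open>p\<close>. As \<open>inj_on\<close> speaks about the set of
  arcs of \<open>p\<close>, the definition is intended for paths, which do not repeat arcs.
\<close>

definition rainbow :: "nat \<Rightarrow> (int \<times> int) list \<Rightarrow> (int \<times> int) list \<Rightarrow> bool" where
  "rainbow r H p \<longleftrightarrow>
     (\<forall>e \<in> set p. \<exists>!k. k \<in> {0..<int r} \<and> e \<in> set (translate r H k)) \<and>
     inj_on (dev_colour r H) (set p)"

text \<open>
  Here \<open>e k\<close> is the arc selected from the \<open>k\<close>-th translate. A path of length \<open>r\<close> has \<open>r\<close> distinct
  arcs and \<open>r + 1\<close> distinct vertices, so the selected arcs are necessarily pairwise distinct.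
\<close>

definition chain_compatible :: "nat \<Rightarrow> (int \<times> int) list \<Rightarrow> bool" where
  "chain_compatible r H \<longleftrightarrow>
     (\<exists>e. (\<forall>k \<in> {0..<int r}. e k \<in> set (translate r H k)) \<and>
          (\<exists>u p v. pre_digraph.apath (with_proj (C4 r)) u p v \<and> length p = r \<and>
                   set p = e ` {0..<int r}))"

definition even_path :: "nat \<Rightarrow> (int \<times> int) list" where
  "even_path r = map (\<lambda>i. (2 * int i, 2 * int (i + 1))) [0..<r]"

end

theory Submission
  imports Defs "HOL-Number_Theory.Cong"
begin

text \<open>
  Both words \<open>A\<close> and \<open>B\<close> have the same sum \<open>S = r (r + 1) / 2\<close>, an odd multiple of \<open>r\<close>, and they
  reach their letter \<open>2\<close> (which lies in the common suffix \<open>D'\<close>) after prefixes with the same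
  sum \<open>\<sigma>\<close>. Hence the four arcs of step \<open>2\<close> in \<open>H\<close> have the tails \<open>\<sigma> + j S\<close> for \<open>j < 4\<close>,
  which are exactly the vertices congruent to \<open>\<sigma>\<close> modulo \<open>r\<close>. So the arc \<open>2 i \<rightarrow> 2 i + 2\<close> lies
  in \<open>H\<^sub>k\<close> if and only if \<open>4 k \<equiv> 2 i - \<sigma>\<close> modulo \<open>r\<close>, and as \<open>r\<close> is odd this equation
  determines \<open>k\<close> from \<open>i\<close> and \<open>i\<close> from \<open>k\<close>.
\<close>

section \<open>Arcs of a walk given by its word of steps\<close>

text \<open>The start is written \<open>x mod n\<close> with \<open>x\<close> arbitrary, so that the
  offsets of successive words add up as plain integers when the lemma is iterated.\<close>

lemma walk_of_steps_append:
  "set (walk_of_steps n (x mod n) (u @ v)) =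
     set (walk_of_steps n (x mod n) u) \<union> set (walk_of_steps n ((x + sum_list u) mod n) v)"
proof (induction u arbitrary: x)
  case (Cons s u)
  show ?case
    using Cons.IH[of "x + s"] by (simp add: mod_add_left_eq add.assoc)
qed simp

lemma walk_of_steps_subset:
  assumes "0 < n"
  shows "set (walk_of_steps n (x mod n) w) \<subseteq> {0..<n} \<times> {0..<n}"
proof (induction w arbitrary: x)
  case (Cons s w)
  show ?case
    using Cons.IH[of "x mod n + s"] assms by simp
qed simp

text \<open>Letters in \<open>{0..<n}\<close> are their own residues, so head minus tail recovers
  the letter itself. This serves to exclude arcs of a given step from a walk whose word avoids that
  letter.\<close>

lemma walk_of_steps_diff:
  assumes "(p, q) \<in> set (walk_of_steps n x w)" "set w \<subseteq> {0..<n}"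
  shows "(q - p) mod n \<in> set w"
  using assms
proof (induction w arbitrary: x)
  case (Cons s w)
  have "((x + s) mod n - x) mod n = s"
    using Cons.prems(2) by (simp add: mod_diff_left_eq)
  then show ?case
    using Cons.prems Cons.IH[of "(x + s) mod n"] by auto
qed simp

text \<open>Neither \<open>u\<close> nor \<open>v\<close> can produce an arc of step
  \<open>s\<close>, so only the middle letter does, and its tail is the start shifted by the sum of
  \<open>u\<close>.\<close>

lemma walk_of_steps_single_step:
  assumes u: "set u \<subseteq> {0..<n}" "s \<notin> set u" and v: "set v \<subseteq> {0..<n}" "s \<notin> set v"
    and s: "s \<in> {0..<n}"
  shows "(p, (p + s) mod n) \<in> set (walk_of_steps n (x mod n) (u @ s # v)) \<longleftrightarrow>
         p = (x + sum_list u) mod n"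
proof -
  have d: "((p + s) mod n - p) mod n = s"
    using s by (simp add: mod_diff_left_eq)
  have "(p, (p + s) mod n) \<notin> set (walk_of_steps n y w)" if "set w \<subseteq> {0..<n}" "s \<notin> set w" for y w
    using walk_of_steps_diff[of p "(p + s) mod n" n y w] that d by auto
  then show ?thesis
    using u v by (auto simp: walk_of_steps_append)
qed

section \<open>Arcs of the translates\<close>

text \<open>Shifting by \<open>4 * k\<close> is invertible on reduced representatives, so every
  question about a translate becomes one about \<open>H\<close> alone.\<close>

lemma mem_translate_iff:
  assumes H: "set H \<subseteq> {0..<4 * int r} \<times> {0..<4 * int r}"
    and "a \<in> {0..<4 * int r}" "b \<in> {0..<4 * int r}"
  shows "(a, b) \<in> set (translate r H k) \<longleftrightarrow>
         ((a - 4 * k) mod (4 * int r), (b - 4 * k) mod (4 * int r)) \<in> set H"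
proof -
  let ?n = "4 * int r"
  have shift: "c = (x + 4 * k) mod ?n \<longleftrightarrow> x = (c - 4 * k) mod ?n"
    if "x \<in> {0..<?n}" "c \<in> {0..<?n}" for x c
  proof
    assume "c = (x + 4 * k) mod ?n"
    then have "(c - 4 * k) mod ?n = x mod ?n" by (simp add: mod_diff_left_eq)
    then show "x = (c - 4 * k) mod ?n" using that(1) by simp
  next
    assume "x = (c - 4 * k) mod ?n"
    then have "(x + 4 * k) mod ?n = c mod ?n" by (simp add: mod_add_left_eq)
    then show "c = (x + 4 * k) mod ?n" using that(2) by simp
  qed
  have "(a, b) \<in> set (translate r H k) \<longleftrightarrow>
      (\<exists>e\<in>set H. a = (fst e + 4 * k) mod ?n \<and> b = (snd e + 4 * k) mod ?n)"
    by (simp add: translate_def image_iff case_prod_beta)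
  also have "\<dots> \<longleftrightarrow> (\<exists>e\<in>set H. fst e = (a - 4 * k) mod ?n \<and> snd e = (b - 4 * k) mod ?n)"
  proof (rule bex_cong[OF refl])
    fix e assume "e \<in> set H"
    then have "e \<in> {0..<?n} \<times> {0..<?n}" using H by blast
    then have "fst e \<in> {0..<?n}" "snd e \<in> {0..<?n}" by (simp_all add: mem_Times_iff)
    then show "(a = (fst e + 4 * k) mod ?n \<and> b = (snd e + 4 * k) mod ?n) \<longleftrightarrow>
        (fst e = (a - 4 * k) mod ?n \<and> snd e = (b - 4 * k) mod ?n)"
      using assms(2,3) by (simp only: shift)
  qed
  also have "\<dots> \<longleftrightarrow> ((a - 4 * k) mod ?n, (b - 4 * k) mod ?n) \<in> set H"
    by (metis prod.collapse fst_conv snd_conv)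
  finally show ?thesis .
qed

section \<open>The even path, and the selection of arcs along a rainbow path\<close>

text \<open>The start is generalised from 0 to \<open>m\<close>, so that an induction descending
  from \<open>k\<close> prepends one arc at a time.\<close>

lemma pcas_even_steps:
  "m \<le> k \<Longrightarrow> pcas (2 * int m) (map (\<lambda>i. (2 * int i, 2 * int (i + 1))) [m..<k]) (2 * int k)"
proof (induction m rule: inc_induct)
  case (step m)
  then show ?case by (simp add: upt_rec[of m k])
qed simp

lemma pawalk_verts_even_steps:
  "m \<le> k \<Longrightarrow> pawalk_verts (2 * int m) (map (\<lambda>i. (2 * int i, 2 * int (i + 1))) [m..<k]) =
     map (\<lambda>i. 2 * int i) [m..<Suc k]"
proof (induction m rule: inc_induct)
  case (step m)
  then show ?case by (simp add: upt_rec[of m k] upt_rec[of m "Suc k"])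
qed simp

text \<open>The last vertex \<open>2 * r\<close> is still below \<open>4 * r\<close>, so no
  reduction occurs along the path and its vertices remain distinct.\<close>

lemma apath_even_path:
  assumes "r \<ge> 2"
  shows "pre_digraph.apath (with_proj (C4 r)) 0 (even_path r) (2 * int r)"
proof -
  have "(2 * int i, 2 * int (i + 1)) \<in> parcs (C4 r)" if "i < r" for i
    using that assms by (auto simp: C4_def intro!: exI[of _ 2])
  then have "set (even_path r) \<subseteq> parcs (C4 r)"
    by (auto simp: even_path_def)
  moreover have "pcas 0 (even_path r) (2 * int r)"
    using pcas_even_steps[of 0 r] by (simp add: even_path_def)
  moreover have "distinct (pawalk_verts 0 (even_path r))"
    using pawalk_verts_even_steps[of 0 r]
    by (simp add: even_path_def distinct_map inj_on_def del: upt_Suc)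
  moreover have "0 \<in> pverts (C4 r)"
    using assms by (simp add: C4_def)
  ultimately show ?thesis
    by (simp add: pre_digraph.apath_def pre_digraph.awalk_def cas_with_proj_eq awalk_verts_with_proj_eq)
qed

text \<open>The \<open>r\<close> arcs have distinct colours among \<open>r\<close> possible ones, so
  every colour occurs; the inverse of the colouring then selects one arc from each
  translate.\<close>

lemma chain_compatibleI:
  assumes "pre_digraph.apath (with_proj (C4 r)) u p v" "length p = r" "distinct p"
    and rainbow: "rainbow r H p"
  shows "chain_compatible r H"
proof -
  let ?c = "dev_colour r H"
  have ex1: "\<exists>!k. k \<in> {0..<int r} \<and> e \<in> set (translate r H k)" if "e \<in> set p" for e
    using rainbow that by (simp add: rainbow_def)
  have c: "?c e \<in> {0..<int r} \<and> e \<in> set (translate r H (?c e))" if "e \<in> set p" for e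
    unfolding dev_colour_def by (rule theI'[OF ex1[OF that]])
  have inj: "inj_on ?c (set p)"
    using rainbow by (simp add: rainbow_def)
  have "card (?c ` set p) = r"
    using assms(2,3) inj by (simp add: card_image distinct_card)
  then have image: "?c ` set p = {0..<int r}"
    using c by (intro card_subset_eq) auto
  let ?e = "inv_into (set p) ?c"
  have "?e k \<in> set (translate r H k)" if "k \<in> {0..<int r}" for k
    using c[of "?e k"] that image by (metis f_inv_into_f inv_into_into)
  moreover have "set p = ?e ` {0..<int r}"
    using inj image by (metis inv_into_image_cancel order_refl)
  ultimately show ?thesis
    using assms(1,2) unfolding chain_compatible_def by blast
qed

section \<open>The arcs of step 2 in the starter\<close>

text \<open>An odd \<open>m\<close> is a unit modulo 4, so the four multiples
  \<open>j * (r * m)\<close> represent all multiples of \<open>r\<close> modulo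
  \<open>4 * r\<close>.\<close>

lemma odd_multiple_coset:
  fixes r m c p :: int
  assumes "0 < r" "odd m"
  shows "(\<exists>j\<in>{0..<4}. p = (c + j * (r * m)) mod (4 * r)) \<longleftrightarrow>
         p \<in> {0..<4 * r} \<and> [p = c] (mod r)"
proof
  assume "\<exists>j\<in>{0..<4}. p = (c + j * (r * m)) mod (4 * r)"
  then obtain j where p: "p = (c + j * (r * m)) mod (4 * r)" by blast
  have "[p = c + j * (r * m)] (mod r)"
    unfolding p by (simp add: cong_def mod_mod_cancel)
  moreover have "[c + j * (r * m) = c] (mod r)"
    by (simp add: cong_iff_dvd_diff)
  ultimately show "p \<in> {0..<4 * r} \<and> [p = c] (mod r)"
    using \<open>0 < r\<close> p by (auto intro: cong_trans)
next
  assume p: "p \<in> {0..<4 * r} \<and> [p = c] (mod r)"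
  then obtain z where z: "p = c + r * z"
    by (metis cong_iff_lin cong_sym)
  \<comment> \<open>As \<open>m\<close> is its own inverse modulo 4, the index with
    \<open>j * m\<close> congruent to \<open>z\<close> is \<open>j = z * m mod 4\<close>.\<close>
  have "[m * m = 1] (mod 4)"
  proof -
    obtain t where "m = 2 * t + 1" using \<open>odd m\<close> by (rule oddE)
    then have "m * m = 1 + 4 * (t * t + t)" by (simp add: algebra_simps)
    then show ?thesis by (metis cong_iff_lin cong_sym)
  qed
  then have "[z * m mod 4 * m = z] (mod 4)"
    by (metis cong_def cong_scalar_left mod_mult_left_eq mult.assoc mult.right_neutral)
  then have "[r * (z * m mod 4 * m) = r * z] (mod (r * 4))"
    by (simp add: cong_def mult_mod_right[symmetric])
  then have "[c + (z * m mod 4) * (r * m) = p] (mod (4 * r))"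
    unfolding z by (intro cong_add) (simp_all add: algebra_simps)
  then have "p = (c + (z * m mod 4) * (r * m)) mod (4 * r)"
    using p by (simp add: cong_def)
  then show "\<exists>j\<in>{0..<4}. p = (c + j * (r * m)) mod (4 * r)"
    by (intro bexI[of _ "z * m mod 4"]) auto
qed

text \<open>The first two differences are odd, so the letter 2 comes after them. The prefixes before
  it differ only by exchanging these two differences, hence have the same letters and the same
  sum.\<close>

lemma words_split_at_2:
  assumes "normalized_Rstar_terrace r P" "r \<ge> 4"
  obtains u u' v where "word_A r P = u @ 2 # v" "word_B r P = u' @ 2 # v"
    "set u' = set u" "sum_list u' = sum_list u"
    "distinct (word_A r P)" "set (word_A r P) = {1..int r}"
proof -
  let ?D = "cyclic_diffs r P"
  have D: "distinct ?D" "set ?D = {1..<int r}" and "odd (?D ! 0)" "odd (?D ! 1)"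
    using assms(1) by (simp_all add: normalized_Rstar_terrace_def directed_rotational_terrace_def)
  have "length ?D = r - 1"
    using distinct_card[OF D(1)] D(2) by simp
  then have "Suc (Suc 0) \<le> length ?D" using \<open>r \<ge> 4\<close> by simp
  then obtain a b D' where D': "?D = a # b # D'"
    by (auto simp: Suc_le_length_iff)
  have "2 \<noteq> a" "2 \<noteq> b"
    using \<open>odd (?D ! 0)\<close> \<open>odd (?D ! 1)\<close> D' by auto
  moreover have "2 \<in> set ?D" using D(2) \<open>r \<ge> 4\<close> by simp
  ultimately have "2 \<in> set D'" unfolding D' by simp
  then obtain u v where uv: "D' = u @ 2 # v" by (rule split_list[elim_format]) blast
  have A: "word_A r P = [a, int r, b] @ D'"
    by (simp add: word_A_def D')
  have "int r \<notin> set ?D"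
    unfolding D(2) by simp
  then have "distinct (int r # ?D)"
    using D(1) by simp
  moreover have "distinct (word_A r P) \<longleftrightarrow> distinct (int r # ?D)"
    unfolding A D' distinct.simps append.simps list.set by blast
  ultimately have "distinct (word_A r P)" by blast
  have "set (word_A r P) = insert (int r) (set ?D)"
    unfolding A D' append.simps list.set by (rule insert_commute)
  also have "\<dots> = {1..int r}"
    unfolding D(2) using \<open>r \<ge> 4\<close> by auto
  finally have "set (word_A r P) = {1..int r}" .
  show ?thesis
  proof (rule that)
    show "word_A r P = ([a, int r, b] @ u) @ 2 # v"
      by (simp add: A uv)
    show "word_B r P = ([b, int r, a] @ u) @ 2 # v"
      by (simp add: word_B_def D' uv)
    show "set ([b, int r, a] @ u) = set ([a, int r, b] @ u)"
      by (simp add: insert_commute)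
    show "sum_list ([b, int r, a] @ u) = sum_list ([a, int r, b] @ u)"
      by simp
  qed fact+
qed

lemma double_gauss_sum_int: "2 * \<Sum>{1..int r} = int r * (int r + 1)"
proof (induction r)
  case (Suc r)
  have "{1..int (Suc r)} = insert (int r + 1) {1..int r}" by auto
  then show ?case using Suc.IH by (simp add: algebra_simps)
qed simp

lemma ABAB_starter_step2:
  assumes r: "r mod 4 = 1" "r \<ge> 5" and terrace: "normalized_Rstar_terrace r P"
  obtains \<sigma> where "\<And>p. (p, (p + 2) mod (4 * int r)) \<in> set (ABAB_starter r P) \<longleftrightarrow>
    p \<in> {0..<4 * int r} \<and> [p = \<sigma>] (mod int r)"
proof -
  have "r \<ge> 4" using r(2) by simp
  obtain u u' v where A: "word_A r P = u @ 2 # v" and B: "word_B r P = u' @ 2 # v"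
    and u': "set u' = set u" "sum_list u' = sum_list u"
    and dist: "distinct (word_A r P)" and set_A: "set (word_A r P) = {1..int r}"
    by (rule words_split_at_2[OF terrace \<open>r \<ge> 4\<close>])
  define n where "n = 4 * int r"
  define \<sigma> where "\<sigma> = sum_list u"
  define S where "S = sum_list (word_A r P)"
  \<comment> \<open>The residue 1 modulo 4 makes \<open>(r + 1) / 2 = 2 * q + 1\<close> odd, as the
    coset lemma requires of the factor of \<open>r\<close> in \<open>S\<close>.\<close>
  obtain q where q: "r = 4 * q + 1" using r(1) by (metis mult_div_mod_eq)
  have S: "S = int r * (2 * int q + 1)"
  proof -
    have "S = \<Sum>{1..int r}"
      unfolding S_def using distinct_sum_list_conv_Sum[OF dist] set_A by simp
    then have "2 * S = int r * (int r + 1)"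
      by (simp only: double_gauss_sum_int)
    also have "int r + 1 = 2 * (2 * int q + 1)"
      by (simp add: q)
    finally show ?thesis by (simp add: algebra_simps)
  qed
  have S_B: "S = sum_list (word_B r P)" by (simp add: S_def A B u')
  have "{1..int r} \<subseteq> {0..<n}"
    unfolding n_def using r(2) by auto
  then have sub: "set u \<subseteq> {0..<n}" "set v \<subseteq> {0..<n}" "2 \<in> {0..<n}"
    unfolding set_A[symmetric] A by simp_all
  have two: "2 \<notin> set u" "2 \<notin> set v"
    using dist unfolding A by simp_all
  have A_iff: "(p, (p + 2) mod n) \<in> set (walk_of_steps n (x mod n) (word_A r P)) \<longleftrightarrow>
      p = (x + \<sigma>) mod n" for p x
    unfolding A \<sigma>_def using sub two by (intro walk_of_steps_single_step)
  have B_iff: "(p, (p + 2) mod n) \<in> set (walk_of_steps n (x mod n) (word_B r P)) \<longleftrightarrow>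
      p = (x + \<sigma>) mod n" for p x
    unfolding B \<sigma>_def u'(2)[symmetric]
    using sub two u'(1) by (intro walk_of_steps_single_step) simp_all
  have "(p, (p + 2) mod n) \<in> set (ABAB_starter r P) \<longleftrightarrow>
      p \<in> {0..<4 * int r} \<and> [p = \<sigma>] (mod int r)" for p
  proof -
    have "{0..<4} = {0, 1, 2, 3 :: int}" by auto
    moreover have "(p, (p + 2) mod n) \<in> set (ABAB_starter r P) \<longleftrightarrow>
        p = (0 + \<sigma>) mod n \<or> p = (S + \<sigma>) mod n \<or> p = (2 * S + \<sigma>) mod n \<or> p = (3 * S + \<sigma>) mod n"
    proof -
      have "set (ABAB_starter r P) =
          set (walk_of_steps n (0 mod n) (word_A r P)) \<union> set (walk_of_steps n (S mod n) (word_B r P)) \<union>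
          set (walk_of_steps n ((2 * S) mod n) (word_A r P)) \<union>
          set (walk_of_steps n ((3 * S) mod n) (word_B r P))"
        \<comment> \<open>Each application splits off one block; since both words sum to
          \<open>S\<close>, the blocks start at 0, \<open>S\<close>, \<open>2 * S\<close> and
          \<open>3 * S\<close>.\<close>
        using walk_of_steps_append[of n 0 "word_A r P"]
          walk_of_steps_append[of n S "word_B r P"]
          walk_of_steps_append[of n "2 * S" "word_A r P"]
        by (simp add: ABAB_starter_def n_def[symmetric] S_def[symmetric] S_B[symmetric] Un_assoc)
      then show ?thesis
        by (simp only: Un_iff A_iff B_iff disj_assoc)
    qed
    ultimately have "(p, (p + 2) mod n) \<in> set (ABAB_starter r P) \<longleftrightarrow>
        (\<exists>j\<in>{0..<4}. p = (\<sigma> + j * S) mod n)"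
      by (simp add: add.commute)
    also have "\<dots> \<longleftrightarrow> p \<in> {0..<4 * int r} \<and> [p = \<sigma>] (mod int r)"
      unfolding S n_def by (rule odd_multiple_coset) (use r(2) in simp_all)
    finally show ?thesis .
  qed
  then show ?thesis using that unfolding n_def by blast
qed

section \<open>Colours along the even path\<close>

lemma rainbow_even_path:
  assumes r: "r mod 4 = 1" "r \<ge> 5" and terrace: "normalized_Rstar_terrace r P"
  shows "rainbow r (ABAB_starter r P) (even_path r)"
proof -
  let ?H = "ABAB_starter r P" and ?n = "4 * int r"
  have H: "set ?H \<subseteq> {0..<?n} \<times> {0..<?n}"
    using walk_of_steps_subset[of ?n 0] r(2) by (simp add: ABAB_starter_def)
  \<comment> \<open>Invertibility of 4 modulo \<open>r\<close> determines the colour of an arc, and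
    that of 2 recovers the arc from its colour.\<close>
  have odd: "odd (int r)" using r(1) by presburger
  then have coprime_2: "coprime 2 (int r)"
    by simp
  then have coprime_4: "coprime 4 (int r)"
    using coprime_mult_left_iff[of 2 2 "int r"] by simp
  obtain \<sigma> where \<sigma>: "\<And>p. (p, (p + 2) mod ?n) \<in> set ?H \<longleftrightarrow> p \<in> {0..<?n} \<and> [p = \<sigma>] (mod int r)"
    by (rule ABAB_starter_step2[OF assms]) blast
  have mem: "(2 * int i, 2 * int (i + 1)) \<in> set (translate r ?H k) \<longleftrightarrow>
      [4 * k = 2 * int i - \<sigma>] (mod int r)" if "i < r" for i k
  proof -
    let ?p = "(2 * int i - 4 * k) mod ?n"
    \<comment> \<open>Shifting back by \<open>4 * k\<close> preserves the step 2, so the description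
      of the arcs of step 2 in \<open>?H\<close> applies.\<close>
    have "(?p + 2) mod ?n = (2 * int (i + 1) - 4 * k) mod ?n"
      unfolding mod_add_left_eq by (simp add: algebra_simps)
    then have "(2 * int i, 2 * int (i + 1)) \<in> set (translate r ?H k) \<longleftrightarrow>
        (?p, (?p + 2) mod ?n) \<in> set ?H"
      using mem_translate_iff[OF H, of "2 * int i" "2 * int (i + 1)" k] that by simp
    also have "\<dots> \<longleftrightarrow> [?p = \<sigma>] (mod int r)"
      unfolding \<sigma> using r(2) by simp
    \<comment> \<open>The inner reduction modulo \<open>4 * r\<close> disappears because
      \<open>r\<close> divides \<open>4 * r\<close>.\<close>
    also have "\<dots> \<longleftrightarrow> [2 * int i - 4 * k = \<sigma>] (mod int r)"
      by (simp add: cong_def mod_mod_cancel)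
    also have "\<dots> \<longleftrightarrow> [4 * k = 2 * int i - \<sigma>] (mod int r)"
      by (simp add: cong_iff_dvd_diff dvd_diff_commute algebra_simps)
    finally show ?thesis .
  qed
  have ex1: "\<exists>!k. k \<in> {0..<int r} \<and> e \<in> set (translate r ?H k)" if "e \<in> set (even_path r)" for e
  proof -
    from that obtain i where i: "i < r" "e = (2 * int i, 2 * int (i + 1))"
      by (auto simp: even_path_def)
    \<comment> \<open>A solution is \<open>2 * i - \<sigma>\<close> times an inverse
      \<open>y\<close> of 4 modulo \<open>r\<close>; it is reduced into the colour range
      afterwards.\<close>
    obtain k where k: "[4 * k = 2 * int i - \<sigma>] (mod int r)"
    proof -
      obtain y where "[4 * y = 1] (mod int r)"
        using cong_solve_coprime_int[OF coprime_4] by blast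
      then have "[4 * y * (2 * int i - \<sigma>) = 1 * (2 * int i - \<sigma>)] (mod int r)"
        by (rule cong_scalar_right)
      then show ?thesis using that by (simp add: mult.assoc)
    qed
    have "k' = k mod int r" if "k' \<in> {0..<int r}" "[4 * k' = 2 * int i - \<sigma>] (mod int r)" for k'
    proof -
      have "[4 * k' = 4 * k] (mod int r)"
        by (rule cong_trans[OF that(2) cong_sym[OF k]])
      then have "[k' = k] (mod int r)"
        using coprime_4 by (simp add: cong_mult_lcancel)
      then show ?thesis using that(1) by (simp add: cong_def)
    qed
    moreover have "[4 * (k mod int r) = 2 * int i - \<sigma>] (mod int r)"
      using k by (simp add: cong_def mod_mult_right_eq)
    ultimately show ?thesis
      unfolding i(2) mem[OF i(1)] using r(2) by (intro ex1I[of _ "k mod int r"]) auto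
  qed
  have colour: "e \<in> set (translate r ?H (dev_colour r ?H e))" if "e \<in> set (even_path r)" for e
    unfolding dev_colour_def using theI'[OF ex1[OF that]] by blast
  have "inj_on (dev_colour r ?H) (set (even_path r))"
  proof (rule inj_onI)
    fix e f assume e: "e \<in> set (even_path r)" and f: "f \<in> set (even_path r)"
      and eq: "dev_colour r ?H e = dev_colour r ?H f"
    obtain i where i: "i < r" "e = (2 * int i, 2 * int (i + 1))"
      using e by (auto simp: even_path_def)
    obtain j where j: "j < r" "f = (2 * int j, 2 * int (j + 1))"
      using f by (auto simp: even_path_def)
    have "[4 * dev_colour r ?H e = 2 * int i - \<sigma>] (mod int r)"
      using colour[OF e] unfolding mem[OF i(1), symmetric] i(2) .
    moreover have "[4 * dev_colour r ?H e = 2 * int j - \<sigma>] (mod int r)"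
      using colour[OF f] unfolding eq mem[OF j(1), symmetric] j(2) .
    ultimately have "[2 * int i - \<sigma> = 2 * int j - \<sigma>] (mod int r)"
      by (rule cong_trans[OF cong_sym])
    then have "[2 * int i = 2 * int j] (mod int r)"
      by (simp add: cong_iff_dvd_diff)
    then have "[int i = int j] (mod int r)"
      using coprime_2 by (simp add: cong_mult_lcancel)
    \<comment> \<open>Both indices lie below \<open>r\<close>, so congruence modulo \<open>r\<close>
      is equality.\<close>
    then show "e = f" using i j by (simp add: cong_def)
  qed
  then show ?thesis using ex1 by (simp add: rainbow_def)
qed

theorem lemma5p4:
  fixes r :: nat and P :: "int list" and H :: "(int \<times> int) list"
  assumes "r mod 4 = 1" and "r \<ge> 9"
    and "normalized_Rstar_terrace r P"
    and "H = ABAB_starter r P"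
  shows "pre_digraph.apath (with_proj (C4 r)) 0 (even_path r) (2 * int r)
    \<and> rainbow r H (even_path r)
    \<and> chain_compatible r H"
proof (intro conjI)
  show path: "pre_digraph.apath (with_proj (C4 r)) 0 (even_path r) (2 * int r)"
    using assms(2) by (intro apath_even_path) simp
  show rainbow: "rainbow r H (even_path r)"
    using assms by (simp add: rainbow_even_path)
  have "length (even_path r) = r" "distinct (even_path r)"
    by (simp_all add: even_path_def distinct_map inj_on_def)
  then show "chain_compatible r H"
    by (rule chain_compatibleI[OF path _ _ rainbow])
qed

end
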